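(* For every integer $r\ge 1$, the odd independence density $\varrho_{\mathrm{od}}$ of the infinite $r$-Rook graph satisfies $$\frac{1}{2r+1}\ \le\ \varrho_{\mathrm{od}}\ \le\ \frac{3}{4r+3}.$$
   Context: The infinite $r$-Rook graph has vertex set $\mathbb{Z}^2$; two distinct vertices $(a,b),(a',b')$ are adjacent iff either $a=a'$ and $|b-b'|\le r$, or $b=b'$ and $|a-a'|\le r$. $N(v)$ is the open neighborhood of $v$. An odd independent set is an independent set $S$ of vertices such that every vertex $v\notin S$ has either $N(v)\cap S=\varnothing$ or $|N(v)\cap S|$ odd. The odd independence density is $\varrho_{\mathrm{od}}:=\sup_S\limsup_{H_n,\ n\to\infty}|S\cap V(H_n)|/|V(H_n)|$, where $S$ ranges over all odd independent sets of the graph and $H_n$ ranges over all subgraphs induced by the vertices in axis-parallel $n\times n$ squares of $\mathbb{Z}^2$. *)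

theory Defs
  imports Complex_Main "HOL-Library.Extended_Real" "HOL-Library.Liminf_Limsup"
begin

text \<open>Simple graphs on the type \<open>'a\<close>, with every element a vertex, are given by their adjacency
  relation.\<close>

definition rook_adj :: "nat \<Rightarrow> int \<times> int \<Rightarrow> int \<times> int \<Rightarrow> bool" where
  "rook_adj r v w \<longleftrightarrow> v \<noteq> w \<and>
     (fst v = fst w \<and> \<bar>snd v - snd w\<bar> \<le> int r \<or>
      snd v = snd w \<and> \<bar>fst v - fst w\<bar> \<le> int r)"

definition nbhd :: "('a \<Rightarrow> 'a \<Rightarrow> bool) \<Rightarrow> 'a \<Rightarrow> 'a set" where
  "nbhd adj v = {w. adj v w}"

definition independent_set :: "('a \<Rightarrow> 'a \<Rightarrow> bool) \<Rightarrow> 'a set \<Rightarrow> bool" where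
  "independent_set adj S \<longleftrightarrow> (\<forall>v\<in>S. \<forall>w\<in>S. \<not> adj v w)"

text \<open>Meant for locally finite graphs: \<open>card\<close> of an infinite set is \<open>0\<close>, so a vertex with
  infinitely many neighbours in \<open>S\<close> would violate the condition.\<close>

definition odd_independent_set :: "('a \<Rightarrow> 'a \<Rightarrow> bool) \<Rightarrow> 'a set \<Rightarrow> bool" where
  "odd_independent_set adj S \<longleftrightarrow> independent_set adj S \<and>
     (\<forall>v. v \<notin> S \<longrightarrow> nbhd adj v \<inter> S = {} \<or> odd (card (nbhd adj v \<inter> S)))"

definition square :: "nat \<Rightarrow> int \<times> int \<Rightarrow> (int \<times> int) set" where
  "square n p = {fst p..<fst p + int n} \<times> {snd p..<snd p + int n}"

text \<open>The limit superior along all squares \<open>H\<^sub>n\<close> as \<open>n\<close> tends to infinity: for each \<open>n\<close> the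
  position of the square is arbitrary, hence the inner supremum. It is taken in \<^typ>\<open>ereal\<close>
  so that all suprema exist; every ratio lies in the unit interval (the ratio for \<open>n = 0\<close>
  is \<open>0/0 = 0\<close> and does not affect the limit superior).\<close>

definition upper_density :: "(int \<times> int) set \<Rightarrow> ereal" where
  "upper_density S =
     limsup (\<lambda>n. SUP p. ereal (real (card (S \<inter> square n p)) / real (card (square n p))))"

definition odd_independence_density :: "(int \<times> int \<Rightarrow> int \<times> int \<Rightarrow> bool) \<Rightarrow> ereal" where
  "odd_independence_density adj = (SUP S \<in> {S. odd_independent_set adj S}. upper_density S)"

end

theory Submission
  imports Defs "HOL-Real_Asymp.Real_Asymp"
begin

text \<open>
  Lower bound. The set of all \<open>(x, y)\<close> with \<open>y mod (2r + 1) = x mod (r + 1)\<close> is odd independent.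
  Each column meets it in a residue class modulo \<open>2r + 1\<close>, so a vertex outside the set has exactly
  one neighbour in the set along its column. Each row either misses the set or meets it in a
  residue class modulo \<open>r + 1\<close>, so such a vertex has \<open>0\<close> or \<open>2\<close> neighbours in the set along its row;
  the total is \<open>1\<close> or \<open>3\<close>. By columns, the density is \<open>1 / (2r + 1)\<close>.

  Upper bound. The neighbourhood of a vertex is the disjoint union of four cliques of size \<open>r\<close>, each
  of which meets an independent set at most once. Hence a vertex has at most \<open>4\<close> neighbours in an odd
  independent set, and by parity at most \<open>3\<close>. For the part \<open>A\<close> of the set in an \<open>n\<times>n\<close> square, count
  the edges leaving \<open>A\<close>: each of its points has \<open>4r\<close> neighbours, all outside the set and inside the
  square enlarged by \<open>r\<close> on every side, and each of these receives at most \<open>3\<close> edges. Thus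
  \<open>4r |A| \<le> 3 ((n + 2r)\<^sup>2 - |A|)\<close>, and the bound follows as \<open>n\<close> tends to infinity.
\<close>

section \<open>Neighbourhoods in the rook graph\<close>

lemma nbhd_rook:
  "nbhd (rook_adj r) (a, b) =
     {a - int r..<a} \<times> {b} \<union> {a<..a + int r} \<times> {b} \<union>
     {a} \<times> {b - int r..<b} \<union> {a} \<times> {b<..b + int r}"
  by (auto simp: nbhd_def rook_adj_def)

lemma finite_nbhd_rook: "finite (nbhd (rook_adj r) v)"
  by (cases v) (simp add: nbhd_rook)

lemma card_nbhd_rook: "card (nbhd (rook_adj r) v) = 4 * r"
proof (cases v)
  case (Pair a b)
  show ?thesis
    unfolding Pair nbhd_rook by (subst card_Un_disjoint, force, force, force)+ simp
qed

lemma rook_adj_sym: "rook_adj r v w \<longleftrightarrow> rook_adj r w v"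
  by (auto simp: rook_adj_def)

lemma independent_set_clique_card_le_1:
  assumes "independent_set adj S" "finite C" "\<And>v w. v \<in> C \<Longrightarrow> w \<in> C \<Longrightarrow> v \<noteq> w \<Longrightarrow> adj v w"
  shows "card (C \<inter> S) \<le> 1"
proof -
  have "finite (C \<inter> S)"
    using assms(2) by blast
  moreover have "v = w" if "v \<in> C \<inter> S" "w \<in> C \<inter> S" for v w
    using assms(1,3) that unfolding independent_set_def by blast
  ultimately show ?thesis
    by (simp add: card_le_Suc0_iff_eq)
qed

lemma card_nbhd_rook_independent_le_4:
  assumes "independent_set (rook_adj r) S"
  shows "card (nbhd (rook_adj r) v \<inter> S) \<le> 4"
proof (cases v)
  case (Pair a b)
  let ?C1 = "{a - int r..<a} \<times> {b}" and ?C2 = "{a<..a + int r} \<times> {b}"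
    and ?C3 = "{a} \<times> {b - int r..<b}" and ?C4 = "{a} \<times> {b<..b + int r}"
  have "card (?C1 \<inter> S) \<le> 1" "card (?C2 \<inter> S) \<le> 1" "card (?C3 \<inter> S) \<le> 1" "card (?C4 \<inter> S) \<le> 1"
    by (rule independent_set_clique_card_le_1[OF assms]; force simp: rook_adj_def)+
  moreover have "nbhd (rook_adj r) v \<inter> S = (?C1 \<inter> S) \<union> (?C2 \<inter> S) \<union> (?C3 \<inter> S) \<union> (?C4 \<inter> S)"
    unfolding Pair nbhd_rook by blast
  then have "card (nbhd (rook_adj r) v \<inter> S)
      \<le> card (?C1 \<inter> S) + card (?C2 \<inter> S) + card (?C3 \<inter> S) + card (?C4 \<inter> S)"
    by (simp only:) (meson add_mono card_Un_le le_refl order_trans)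
  ultimately show ?thesis
    by linarith
qed

lemma card_nbhd_rook_odd_independent_le_3:
  assumes "odd_independent_set (rook_adj r) S" "v \<notin> S"
  shows "card (nbhd (rook_adj r) v \<inter> S) \<le> 3"
proof -
  have "card (nbhd (rook_adj r) v \<inter> S) \<le> 4"
    using assms(1) by (intro card_nbhd_rook_independent_le_4) (simp add: odd_independent_set_def)
  moreover have "card (nbhd (rook_adj r) v \<inter> S) \<noteq> 4"
    using assms unfolding odd_independent_set_def by (metis card.empty even_numeral zero_neq_numeral)
  ultimately show ?thesis
    by linarith
qed

section \<open>The upper bound\<close>

lemma finite_square: "finite (square n p)"
  by (simp add: square_def)

lemma card_square: "card (square n p) = n * n"
  by (simp add: square_def card_cartesian_product)

lemma card_odd_independent_square_le:
  assumes S: "odd_independent_set (rook_adj r) S"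
  shows "(4 * r + 3) * card (S \<inter> square n p) \<le> 3 * (n + 2 * r)\<^sup>2"
proof -
  let ?A = "S \<inter> square n p"
  \<comment> \<open>The square enlarged by \<open>r\<close> on every side contains all neighbours of points of \<open>?A\<close>.\<close>
  let ?Q = "square (n + 2 * r) (fst p - int r, snd p - int r)"
  have fin: "finite ?A" "finite (?Q - ?A)"
    by (simp_all add: finite_square)
  have "?A \<subseteq> ?Q"
    by (auto simp: square_def)
  have "4 * r * card ?A = (\<Sum>v\<in>?A. card {w \<in> ?Q - ?A. rook_adj r v w})"
  proof -
    have "{w \<in> ?Q - ?A. rook_adj r v w} = nbhd (rook_adj r) v" if "v \<in> ?A" for v
    proof -
      have "w \<in> ?Q - ?A" if "rook_adj r v w" for w
      proof -
        have "w \<notin> S"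
          using S that \<open>v \<in> ?A\<close> by (auto simp: odd_independent_set_def independent_set_def)
        moreover have "w \<in> ?Q"
          using that \<open>v \<in> ?A\<close> by (cases v; cases w) (auto simp: square_def rook_adj_def)
        ultimately show ?thesis
          by blast
      qed
      then show ?thesis
        by (auto simp: nbhd_def)
    qed
    then show ?thesis
      by (simp add: card_nbhd_rook)
  qed
  also have "\<dots> = (\<Sum>w\<in>?Q - ?A. card {v \<in> ?A. rook_adj r v w})"
    by (rule sum_multicount_gen) (use fin in auto)
  also have "\<dots> \<le> (\<Sum>w\<in>?Q - ?A. 3)"
  proof (rule sum_mono)
    fix w assume "w \<in> ?Q - ?A"
    show "card {v \<in> ?A. rook_adj r v w} \<le> 3"
    proof (cases "w \<in> S")
      case True
      then have "{v \<in> ?A. rook_adj r v w} = {}"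
        using S by (auto simp: odd_independent_set_def independent_set_def)
      then show ?thesis
        by (simp only: card.empty)
    next
      case False
      have "card {v \<in> ?A. rook_adj r v w} \<le> card (nbhd (rook_adj r) w \<inter> S)"
      proof (rule card_mono)
        show "{v \<in> ?A. rook_adj r v w} \<subseteq> nbhd (rook_adj r) w \<inter> S"
          using rook_adj_sym[of r w] by (auto simp only: nbhd_def)
      qed (simp add: finite_nbhd_rook)
      with card_nbhd_rook_odd_independent_le_3[OF S False] show ?thesis
        by linarith
    qed
  qed
  also have "\<dots> = 3 * (card ?Q - card ?A)"
    using \<open>?A \<subseteq> ?Q\<close> fin by (simp add: card_Diff_subset)
  finally have "4 * r * card ?A \<le> 3 * (card ?Q - card ?A)" .
  moreover have "card ?A \<le> card ?Q"
    using \<open>?A \<subseteq> ?Q\<close> by (simp add: card_mono finite_square)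
  ultimately show ?thesis
    by (simp add: card_square power2_eq_square algebra_simps)
qed

lemma upper_density_odd_independent_le:
  assumes "odd_independent_set (rook_adj r) S"
  shows "upper_density S \<le> ereal (3 / (4 * real r + 3))"
proof -
  let ?f = "\<lambda>n. 3 * (real n + 2 * real r)\<^sup>2 / ((4 * real r + 3) * (real n)\<^sup>2)"
  have bound: "ereal (real (card (S \<inter> square n p)) / real (card (square n p))) \<le> ereal (?f n)"
    for n p
  proof -
    have "(4 * real r + 3) * real (card (S \<inter> square n p)) \<le> 3 * (real n + 2 * real r)\<^sup>2"
      using card_odd_independent_square_le[OF assms, of n p, folded of_nat_le_iff[where 'a = real]]
      by simp
    then have "real (card (S \<inter> square n p)) \<le> 3 * (real n + 2 * real r)\<^sup>2 / (4 * real r + 3)"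
      by (simp add: field_simps)
    from divide_right_mono[OF this, of "(real n)\<^sup>2"] show ?thesis
      by (simp add: card_square power2_eq_square)
  qed
  have "upper_density S \<le> limsup (\<lambda>n. ereal (?f n))"
    unfolding upper_density_def
    by (intro Limsup_mono always_eventually allI SUP_least bound)
  moreover have "(\<lambda>n. ereal (?f n)) \<longlonglongrightarrow> ereal (3 / (4 * real r + 3))"
    unfolding lim_ereal by (real_asymp simp: divide_inverse)
  then have "limsup (\<lambda>n. ereal (?f n)) = ereal (3 / (4 * real r + 3))"
    by (rule lim_imp_Limsup[OF sequentially_bot])
  ultimately show ?thesis
    by simp
qed

section \<open>Residue classes in windows of integers\<close>

lemma window_residue_class:
  fixes a p c :: int
  assumes "0 \<le> c" "c < p"
  obtains z where "{x \<in> {a..<a + p}. x mod p = c} = {z}"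
proof
  show "{x \<in> {a..<a + p}. x mod p = c} = {a + (c - a) mod p}" (is "?L = {?z}")
  proof (intro equalityI subsetI)
    fix x assume x: "x \<in> ?L"
    then have "(x - a) mod p = (c - a) mod p"
      using assms by (metis (mono_tags) mem_Collect_eq mod_diff_left_eq)
    moreover have "(x - a) mod p = x - a"
      using x by (intro mod_pos_pos_trivial) auto
    ultimately show "x \<in> {?z}"
      by simp
  next
    fix x assume "x \<in> {?z}"
    moreover have "?z mod p = c"
      using assms by (simp add: mod_add_right_eq)
    ultimately show "x \<in> ?L"
      using assms by simp
  qed
qed

lemma card_residue_class_interval:
  fixes a p c :: int
  assumes "0 \<le> c" "c < p"
  shows "card {x \<in> {a..<a + int k * p}. x mod p = c} = k"
proof (induction k)
  case 0
  show ?case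
    by simp
next
  case (Suc k)
  let ?b = "a + int k * p"
  obtain z where z: "{x \<in> {?b..<?b + p}. x mod p = c} = {z}"
    using window_residue_class[OF assms] .
  have "a \<le> ?b" "?b \<le> ?b + p"
    using assms by simp_all
  then have "{a..<?b} \<union> {?b..<?b + p} = {a..<?b + p}"
    by (rule ivl_disj_un_two(3))
  moreover have "a + int (Suc k) * p = ?b + p"
    by (simp add: algebra_simps)
  ultimately have "{a..<a + int (Suc k) * p} = {a..<?b} \<union> {?b..<?b + p}"
    by (simp only:)
  then have split: "{x \<in> {a..<a + int (Suc k) * p}. x mod p = c}
      = {x \<in> {a..<?b}. x mod p = c} \<union> {x \<in> {?b..<?b + p}. x mod p = c}"
    by blast
  have fin: "finite {x \<in> {u..<v}. x mod p = c}" for u v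
    by (rule finite_subset[OF Collect_restrict]) simp
  have "card {x \<in> {a..<a + int (Suc k) * p}. x mod p = c}
      = card {x \<in> {a..<?b}. x mod p = c} + card {x \<in> {?b..<?b + p}. x mod p = c}"
    unfolding split by (intro card_Un_disjoint fin) auto
  then show ?case
    unfolding z Suc.IH by simp
qed

lemma mod_eq_imp_eq:
  fixes x y p :: int
  assumes "x mod p = y mod p" "\<bar>x - y\<bar> < p"
  shows "x = y"
proof -
  have "p dvd x - y"
    using assms(1) by (simp add: mod_eq_dvd_iff)
  with assms(2) show ?thesis
    using zdvd_imp_le[of p "\<bar>x - y\<bar>"] by (cases "x = y") auto
qed

section \<open>An odd independent set of density 1/(2r+1)\<close>

text \<open>Column \<open>x\<close> of this set is the residue class of \<open>x mod (r + 1)\<close> modulo \<open>2r + 1\<close>. Since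
  \<open>x mod (r + 1)\<close> takes only the values \<open>0, \<dots>, r\<close>, row \<open>y\<close> is the residue class of
  \<open>y mod (2r + 1)\<close> modulo \<open>r + 1\<close> if \<open>y mod (2r + 1) \<le> r\<close>, and empty otherwise.\<close>

definition rook_pattern :: "nat \<Rightarrow> (int \<times> int) set" where
  "rook_pattern r = {(x, y). y mod (2 * int r + 1) = x mod (int r + 1)}"

lemma independent_set_rook_pattern: "independent_set (rook_adj r) (rook_pattern r)"
  unfolding independent_set_def
proof (intro ballI notI)
  fix v w assume vw: "v \<in> rook_pattern r" "w \<in> rook_pattern r" "rook_adj r v w"
  obtain x y x' y' where "v = (x, y)" "w = (x', y')"
    by (cases v; cases w)
  with vw have "y mod (2 * int r + 1) = x mod (int r + 1)"
      "y' mod (2 * int r + 1) = x' mod (int r + 1)" "(x, y) \<noteq> (x', y')"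
      "x = x' \<and> \<bar>y - y'\<bar> \<le> int r \<or> y = y' \<and> \<bar>x - x'\<bar> \<le> int r"
    by (auto simp: rook_pattern_def rook_adj_def)
  then show False
    using mod_eq_imp_eq[of y "2 * int r + 1" y'] mod_eq_imp_eq[of x "int r + 1" x'] by auto
qed

lemma odd_independent_set_rook_pattern: "odd_independent_set (rook_adj r) (rook_pattern r)"
proof -
  have "odd (card (nbhd (rook_adj r) v \<inter> rook_pattern r))" if "v \<notin> rook_pattern r" for v
  proof (cases v)
    case (Pair x y)
    let ?p = "2 * int r + 1" and ?q = "int r + 1"
    have ne: "y mod ?p \<noteq> x mod ?q"
      using that by (simp add: Pair rook_pattern_def)
    have xq: "0 \<le> x mod ?q" "x mod ?q < ?q" for x
      by (simp, intro pos_mod_bound, simp)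
    \<comment> \<open>The vertices within distance \<open>r\<close> in the column form a window of length \<open>2r + 1\<close>.\<close>
    obtain y' where y': "{z \<in> {y - int r..<y - int r + ?p}. z mod ?p = x mod ?q} = {y'}"
      using window_residue_class[of "x mod ?q" ?p "y - int r"] xq[of x] by auto
    have col: "z mod ?p = x mod ?q \<and> \<bar>z - y\<bar> \<le> int r \<longleftrightarrow> z = y'" for z
      using eqset_imp_iff[OF y', of z] by auto
    have "y' \<noteq> y"
      using col ne by blast
    show ?thesis
    proof (cases "y mod ?p \<le> int r")
      case True
      then have c: "0 \<le> y mod ?p" "y mod ?p < ?q"
        by simp_all
      \<comment> \<open>The vertices within distance \<open>r\<close> in the row are covered by two windows of length \<open>r + 1\<close>
        that share only \<open>x\<close>, which is not in the residue class.\<close>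
      obtain x1 where x1: "{z \<in> {x - int r..<x - int r + ?q}. z mod ?q = y mod ?p} = {x1}"
        using window_residue_class[OF c] .
      obtain x2 where x2: "{z \<in> {x..<x + ?q}. z mod ?q = y mod ?p} = {x2}"
        using window_residue_class[OF c] .
      have left: "z mod ?q = y mod ?p \<and> x - int r \<le> z \<and> z \<le> x \<longleftrightarrow> z = x1" for z
        using eqset_imp_iff[OF x1, of z] by auto
      have right: "z mod ?q = y mod ?p \<and> x \<le> z \<and> z \<le> x + int r \<longleftrightarrow> z = x2" for z
        using eqset_imp_iff[OF x2, of z] by auto
      have x12: "x1 < x" "x < x2"
        using left[of x1] right[of x2] ne by (force simp: order.order_iff_strict)+
      have "nbhd (rook_adj r) v \<inter> rook_pattern r = {(x, y'), (x1, y), (x2, y)}"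
      proof (intro set_eqI)
        fix w :: "int \<times> int"
        obtain a b where w: "w = (a, b)"
          by (cases w)
        have row: "a mod ?q = y mod ?p \<and> \<bar>a - x\<bar> \<le> int r \<longleftrightarrow> a = x1 \<or> a = x2"
          using left[of a] right[of a] by linarith
        have "w \<in> nbhd (rook_adj r) v \<inter> rook_pattern r \<longleftrightarrow>
            a = x \<and> b mod ?p = x mod ?q \<and> \<bar>b - y\<bar> \<le> int r \<or>
            b = y \<and> a mod ?q = y mod ?p \<and> \<bar>a - x\<bar> \<le> int r"
          using ne by (auto simp: w Pair nbhd_def rook_adj_def rook_pattern_def abs_minus_commute)
        then show "w \<in> nbhd (rook_adj r) v \<inter> rook_pattern r \<longleftrightarrow> w \<in> {(x, y'), (x1, y), (x2, y)}"
          unfolding row col by (auto simp: w)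
      qed
      then show ?thesis
        using x12 by simp
    next
      case False
      have "nbhd (rook_adj r) v \<inter> rook_pattern r = {(x, y')}"
      proof (intro set_eqI)
        fix w :: "int \<times> int"
        obtain a b where w: "w = (a, b)"
          by (cases w)
        have "y mod ?p \<noteq> a mod ?q"
          using False xq(2)[of a] by linarith
        then have "w \<in> nbhd (rook_adj r) v \<inter> rook_pattern r \<longleftrightarrow>
            a = x \<and> b mod ?p = x mod ?q \<and> \<bar>b - y\<bar> \<le> int r"
          using ne by (auto simp: w Pair nbhd_def rook_adj_def rook_pattern_def abs_minus_commute)
        then show "w \<in> nbhd (rook_adj r) v \<inter> rook_pattern r \<longleftrightarrow> w \<in> {(x, y')}"
          unfolding col by (simp add: w)
      qed
      then show ?thesis
        by simp
    qed
  qed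
  then show ?thesis
    using independent_set_rook_pattern by (simp add: odd_independent_set_def)
qed

lemma card_rook_pattern_square:
  "card (rook_pattern r \<inter> square (k * (2 * r + 1)) p) = k * (2 * r + 1) * k"
proof -
  let ?n = "k * (2 * r + 1)" and ?p = "2 * int r + 1" and ?q = "int r + 1"
  let ?X = "{fst p..<fst p + int ?n}"
  let ?Y = "\<lambda>x. {y \<in> {snd p..<snd p + int k * ?p}. y mod ?p = x mod ?q}"
  have pattern: "rook_pattern r \<inter> square ?n p = Sigma ?X ?Y"
    by (auto simp: rook_pattern_def square_def algebra_simps)
  have card_Y: "card (?Y x) = k" for x
  proof (rule card_residue_class_interval)
    have "x mod ?q < ?q"
      by (intro pos_mod_bound) simp
    then show "x mod ?q < ?p"
      by linarith
  qed simp
  have "card (Sigma ?X ?Y) = (\<Sum>x\<in>?X. card (?Y x))"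
  proof (intro card_SigmaI ballI)
    show "finite (?Y x)" for x
      by (rule finite_subset[OF Collect_restrict]) simp
  qed simp
  then have "card (rook_pattern r \<inter> square ?n p) = (\<Sum>x\<in>?X. k)"
    by (simp only: pattern card_Y)
  then show ?thesis
    by (simp only: sum_constant card_atLeastLessThan_int add_diff_cancel_left' nat_int of_nat_id)
qed

lemma upper_density_rook_pattern: "ereal (1 / (2 * real r + 1)) \<le> upper_density (rook_pattern r)"
proof -
  let ?X = "\<lambda>n. SUP p. ereal (real (card (rook_pattern r \<inter> square n p)) / real (card (square n p)))"
  \<comment> \<open>Along the sizes divisible by \<open>2r + 1\<close> the density is exact.\<close>
  let ?s = "\<lambda>k. Suc k * (2 * r + 1)"
  have "strict_mono ?s"
    by (intro strict_monoI mult_strict_right_mono) simp_all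
  have "ereal (1 / (2 * real r + 1)) \<le> ?X (?s k)" for k
  proof (rule SUP_upper2)
    have "real (card (rook_pattern r \<inter> square (?s k) (0, 0))) / real (card (square (?s k) (0, 0)))
        = real (?s k * Suc k) / real (?s k * ?s k)"
      by (simp only: card_rook_pattern_square card_square)
    also have "\<dots> = real (Suc k) / real (?s k)"
      unfolding of_nat_mult[of "?s k"] by (rule mult_divide_mult_cancel_left) (simp del: of_nat_Suc)
    also have "\<dots> = 1 / (2 * real r + 1)"
      unfolding of_nat_mult by (simp del: of_nat_Suc)
    finally show "ereal (1 / (2 * real r + 1)) \<le>
        ereal (real (card (rook_pattern r \<inter> square (?s k) (0, 0))) / real (card (square (?s k) (0, 0))))"
      by simp
  qed simp
  then have "ereal (1 / (2 * real r + 1)) \<le> limsup (?X \<circ> ?s)"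
    by (intro le_Limsup always_eventually) auto
  also have "\<dots> \<le> limsup ?X"
    by (rule limsup_subseq_mono[OF \<open>strict_mono ?s\<close>])
  finally show ?thesis
    by (simp add: upper_density_def)
qed

section \<open>The bounds on the odd independence density\<close>

theorem theorem19:
  fixes r :: nat
  assumes "r \<ge> 1"
  shows "ereal (1 / (2 * real r + 1)) \<le> odd_independence_density (rook_adj r) \<and>
         odd_independence_density (rook_adj r) \<le> ereal (3 / (4 * real r + 3))"
proof
  show "ereal (1 / (2 * real r + 1)) \<le> odd_independence_density (rook_adj r)"
    unfolding odd_independence_density_def
    by (rule SUP_upper2[where i = "rook_pattern r"])
      (simp_all add: odd_independent_set_rook_pattern upper_density_rook_pattern)
  show "odd_independence_density (rook_adj r) \<le> ereal (3 / (4 * real r + 3))"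
    unfolding odd_independence_density_def
    by (rule SUP_least) (simp add: upper_density_odd_independent_le)
qed

end
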